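(* Let $q\in\mathbb C$ with $0<|q|<1$, let $x=\cos\theta\in[-1,1]$ ($\theta\in[0,\pi]$), let $\gamma\in\mathbb C$, $\alpha,\beta\in(-1,1)\setminus\{0\}$, and let $t\in\mathbb C$ with $|t|<1-\beta^2$. Then $$\frac{(\gamma te^{i\theta};q)_\infty}{(te^{i\theta};q)_\infty}\;{}_3\phi_2\!\left(\gamma,\beta,\beta e^{2i\theta};\ \beta^2,\gamma te^{i\theta};\ q,te^{-i\theta}\right)=\sum_{n=0}^\infty\frac{(\beta,\gamma;q)_n\,t^n}{(\alpha,\beta^2;q)_n}\,C_n(x;\alpha|q)$$ $$\times\;{}_6\phi_5\!\left(\beta/\alpha,\beta q^n,\pm(\gamma q^n)^{1/2},\pm(\gamma q^{n+1})^{1/2};\ \alpha q^{n+1},\pm\beta q^{n/2},\pm\beta q^{(n+1)/2};\ q,\alpha t^2\right).$$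
   Context: Notation: $(a;q)_0=1$, $(a;q)_n=\prod_{j=0}^{n-1}(1-aq^j)$, $(a;q)_\infty=\prod_{j\ge0}(1-aq^j)$, $(a_1,\dots,a_r;q)_n=\prod_i(a_i;q)_n$ (also for $n=\infty$). In a list of parameters, $\pm a$ stands for the two entries $a,-a$; square roots occurring in $\pm$ pairs may be chosen arbitrarily, a square root $q^{1/2}$ is fixed and $q^{m/2}=(q^{1/2})^m$. The basic hypergeometric series, with upper parameters listed before the first semicolon and lower parameters before the second, is $${}_r\phi_s(a_1,\dots,a_r;b_1,\dots,b_s;q,z)=\sum_{k=0}^\infty\frac{(a_1,\dots,a_r;q)_k}{(q,b_1,\dots,b_s;q)_k}\left((-1)^kq^{\binom k2}\right)^{1+s-r}z^k.$$ On the left-hand side, the product of $(\gamma te^{i\theta};q)_\infty$ with the ${}_3\phi_2$ is read, term by term, using $(\gamma te^{i\theta};q)_\infty/(\gamma te^{i\theta};q)_k=(\gamma te^{i\theta}q^k;q)_\infty$ (this only matters when $\gamma te^{i\theta}=q^{-m}$ for some integer $m\ge0$). The continuous $q$-ultraspherical/Rogers polynomials are, for $x=\cos\theta$, $$C_n(x;\beta|q)=\frac{(\beta;q)_n}{(q;q)_n}e^{in\theta}\,{}_2\phi_1\!\left(q^{-n},\beta;\beta^{-1}q^{1-n};q,q\beta^{-1}e^{-2i\theta}\right).$$ *)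

theory Defs
  imports "HOL-Analysis.Analysis"
begin

definition qpoch :: "complex \<Rightarrow> complex \<Rightarrow> nat \<Rightarrow> complex" where
  "qpoch a q n = (\<Prod>j<n. 1 - a * q ^ j)"

definition qpoch_inf :: "complex \<Rightarrow> complex \<Rightarrow> complex" where
  "qpoch_inf a q = (\<Prod>j. 1 - a * q ^ j)"

definition qpochs :: "complex list \<Rightarrow> complex \<Rightarrow> nat \<Rightarrow> complex" where
  "qpochs as q n = (\<Prod>a\<leftarrow>as. qpoch a q n)"

text \<open>The exponent \<open>1 + s - r\<close> may be negative, hence the integer power.\<close>

definition qhyp_term ::
  "complex list \<Rightarrow> complex list \<Rightarrow> complex \<Rightarrow> complex \<Rightarrow> nat \<Rightarrow> complex" where
  "qhyp_term as bs q z k =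
     qpochs as q k / qpochs (q # bs) q k
       * ((- 1) ^ k * q ^ (k choose 2)) powi (1 + int (length bs) - int (length as))
       * z ^ k"

definition qhyp ::
  "complex list \<Rightarrow> complex list \<Rightarrow> complex \<Rightarrow> complex \<Rightarrow> complex" where
  "qhyp as bs q z = (\<Sum>k. qhyp_term as bs q z k)"

text \<open>
  The product of \<open>(w; q)\<^sub>\<infinity>\<close> with the series whose lower parameters are \<open>bs\<close> followed by \<open>w\<close>,
  read term by term through \<open>(w; q)\<^sub>\<infinity> / (w; q)\<^sub>k = (w q\<^sup>k; q)\<^sub>\<infinity>\<close>. This also makes sense when
  \<open>w = q\<^sup>-\<^sup>m\<close>, where the series itself has vanishing denominators; otherwise it is the actual
  product, by the lemma \<open>qhyp_reg_eq\<close> below.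
\<close>

definition qhyp_reg ::
  "complex list \<Rightarrow> complex list \<Rightarrow> complex \<Rightarrow> complex \<Rightarrow> complex \<Rightarrow> complex" where
  "qhyp_reg as bs w q z =
     (\<Sum>k. qpoch_inf (w * q ^ k) q * (qpochs as q k / qpochs (q # bs) q k)
       * ((- 1) ^ k * q ^ (k choose 2)) powi (1 + int (length (bs @ [w])) - int (length as))
       * z ^ k)"

text \<open>
  The continuous \<open>q\<close>-ultraspherical polynomial \<open>C\<^sub>n(x; b | q)\<close> for \<open>x = cos \<theta>\<close> in \<open>[-1, 1]\<close>.
  The series terminates: the terms with \<open>k > n\<close> have numerator \<open>0\<close>, and stay \<open>0\<close> even if their
  denominator vanishes.
\<close>

definition rogers :: "nat \<Rightarrow> real \<Rightarrow> complex \<Rightarrow> complex \<Rightarrow> complex" where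
  "rogers n x b q = (let \<theta> = arccos x in
     qpoch b q n / qpoch q q n * cis (real n * \<theta>)
       * qhyp [q powi (- int n), b] [inverse b * q powi (1 - int n)] q
           (q * inverse b * cis (- 2 * \<theta>)))"

lemma convergent_prod_qpoch:
  fixes a q :: complex
  assumes "norm q < 1"
  shows "convergent_prod (\<lambda>j. 1 - a * q ^ j)"
proof -
  have "summable (\<lambda>j. norm a * norm q ^ j)"
    using assms by (intro summable_mult summable_geometric) auto
  hence "summable (\<lambda>j. norm ((1 - a * q ^ j) - 1))"
    by (simp add: norm_mult norm_power norm_minus_commute)
  hence "abs_convergent_prod (\<lambda>j. 1 - a * q ^ j)"
    by (simp add: summable_imp_abs_convergent_prod)
  thus ?thesis
    by (rule abs_convergent_prod_imp_convergent_prod)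
qed

lemma qpoch_inf_split:
  assumes "norm q < 1"
  shows "qpoch_inf w q = qpoch w q k * qpoch_inf (w * q ^ k) q"
proof -
  have "(\<Prod>j. 1 - w * q ^ j) = (\<Prod>j<k. 1 - w * q ^ j) * (\<Prod>j. 1 - w * q ^ (j + k))"
    using has_prod_ignore_initial_segment'[OF convergent_prod_qpoch[OF assms]]
    by (rule has_prod_unique[symmetric])
  moreover have "w * q ^ (j + k) = w * q ^ k * q ^ j" for j
    by (simp add: power_add)
  ultimately show ?thesis
    by (simp only: qpoch_def qpoch_inf_def)
qed

lemma qhyp_reg_eq:
  assumes "norm q < 1" and "\<And>j. w * q ^ j \<noteq> 1" and "summable (qhyp_term as (bs @ [w]) q z)"
  shows "qhyp_reg as bs w q z = qpoch_inf w q * qhyp as (bs @ [w]) q z"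
proof -
  have nz: "qpoch w q k \<noteq> 0" for k
    unfolding qpoch_def prod_zero_iff[OF finite_lessThan] using assms(2)
    by (metis eq_iff_diff_eq_0)
  have "qpoch_inf w q * qhyp_term as (bs @ [w]) q z k =
        qpoch_inf (w * q ^ k) q * (qpochs as q k / qpochs (q # bs) q k)
          * ((- 1) ^ k * q ^ (k choose 2)) powi (1 + int (length (bs @ [w])) - int (length as))
          * z ^ k" for k
  proof -
    have "qpochs (q # bs @ [w]) q k = qpochs (q # bs) q k * qpoch w q k"
      by (simp add: qpochs_def)
    thus ?thesis
      using nz[of k] qpoch_inf_split[OF assms(1), of w k] by (simp add: qhyp_term_def)
  qed
  thus ?thesis
    unfolding qhyp_reg_def qhyp_def using suminf_mult[OF assms(3), of "qpoch_inf w q"] by simp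
qed

end

theory Submission
  imports Defs
begin

text \<open>
  The theorem combines two classical facts about the Rogers polynomials. The first is the generating
  function \<open>\<Sum>\<^sub>n (\<gamma>; q)\<^sub>n / (\<beta>\<^sup>2; q)\<^sub>n C\<^sub>n(x; \<beta> | q) t\<^sup>n\<close>, whose value is the left-hand side of the
  expansion (\<open>rogers_generating_function\<close>). The second is the connection formula of Rogers
  (\<open>rogers_hom_connection\<close>), which writes \<open>C\<^sub>n(x; \<beta> | q)\<close> as a combination of the
  \<open>C\<^bsub>n-2k\<^esub>(x; \<alpha> | q)\<close>. Substituting the second into the first and collecting the terms with the same
  \<open>C\<^sub>m(x; \<alpha> | q)\<close> leaves, as the coefficient of \<open>C\<^sub>m(x; \<alpha> | q)\<close>, a series over \<open>k\<close> in \<open>\<alpha> t\<^sup>2\<close> with the factors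
  \<open>(\<gamma>; q)\<^bsub>m+2k\<^esub> / (\<beta>\<^sup>2; q)\<^bsub>m+2k\<^esub>\<close>. Separating the even from the odd powers of \<open>q\<close> in these
  factors gives the square-root pairs of the \<open>\<^sub>6\<phi>\<^sub>5\<close> (\<open>qpoch_plus_minus_pairs\<close>). The interchange
  is legitimate because the \<open>C\<^sub>m\<close> grow at most linearly in \<open>m\<close> while \<open>|t| < 1\<close> and \<open>|\<alpha>| < 1\<close>.

  Both facts reduce to finite identities for the symmetric form
  \<open>C\<^sub>n(cos \<theta>; b | q) = \<Sum>\<^sub>j (b; q)\<^sub>j (b; q)\<^bsub>n-j\<^esub> / ((q; q)\<^sub>j (q; q)\<^bsub>n-j\<^esub>) e\<^bsup>i(n-2j)\<theta>\<^esup>\<close>. The generating function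
  needs the \<open>q\<close>-binomial theorem and a \<open>q\<close>-Vandermonde sum; the connection formula is a terminating
  very-well-poised sum, proved by telescoping (\<open>connection_coefficient_identity\<close>).
\<close>

section \<open>Shifted factorials\<close>

lemma qpoch_0 [simp]: "qpoch a q 0 = 1" by (simp add: qpoch_def)
lemma qpoch_Suc: "qpoch a q (Suc n) = qpoch a q n * (1 - a * q ^ n)" by (simp add: qpoch_def)

lemma qpoch_add: "qpoch a q (m + n) = qpoch a q m * qpoch (a * q ^ m) q n"
  by (induction n) (simp_all add: qpoch_Suc power_add mult_ac)

lemma qpoch_eq_0_iff: "qpoch a q n = 0 \<longleftrightarrow> (\<exists>j<n. a * q ^ j = 1)"
  unfolding qpoch_def by auto

lemma norm_mult_power_less_1:
  fixes a q :: complex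
  assumes "norm a < 1" "norm q \<le> 1"
  shows "norm (a * q ^ j) < 1"
proof -
  have "norm a * norm q ^ j \<le> norm a * 1"
    using assms by (intro mult_left_mono power_le_one) auto
  thus ?thesis using assms by (simp add: norm_mult norm_power)
qed

lemma qpoch_nonzero:
  assumes "norm a < 1" "norm q \<le> 1"
  shows "qpoch a q n \<noteq> 0"
  using norm_mult_power_less_1[OF assms] unfolding qpoch_eq_0_iff by (metis norm_one order_less_irrefl)

lemma LIMSEQ_qpoch:
  assumes "norm q < 1"
  shows "(\<lambda>n. qpoch a q n) \<longlonglongrightarrow> qpoch_inf a q"
proof -
  have "(\<lambda>n. qpoch a q (Suc n)) \<longlonglongrightarrow> qpoch_inf a q"
    using convergent_prod_LIMSEQ[OF convergent_prod_qpoch[OF assms, of a]]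
    by (simp only: qpoch_def qpoch_inf_def lessThan_Suc_atMost)
  thus ?thesis by (rule LIMSEQ_imp_Suc)
qed

lemma qpoch_inf_nonzero:
  assumes "norm a < 1" "norm q < 1"
  shows "qpoch_inf a q \<noteq> 0"
  unfolding qpoch_inf_def
proof (rule prodinf_nonzero[OF convergent_prod_qpoch[OF assms(2)]])
  show "1 - a * q ^ j \<noteq> 0" for j
    using norm_mult_power_less_1[of a q j] assms by (metis eq_iff_diff_eq_0 less_imp_le norm_one order_less_irrefl)
qed

lemma Bseq_bound:
  assumes "Bseq X"
  shows "\<exists>K\<ge>0. \<forall>n. norm (X n) \<le> K"
  using BseqE[OF assms] by (metis less_imp_le)

lemma Bseq_qpoch: "norm q < 1 \<Longrightarrow> Bseq (qpoch a q)"
  using LIMSEQ_qpoch by (intro convergent_imp_Bseq convergentI)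

lemma Bseq_inverse_qpoch:
  assumes "norm a < 1" "norm q < 1"
  shows "Bseq (\<lambda>n. 1 / qpoch a q n)"
proof -
  have "(\<lambda>n. 1 / qpoch a q n) \<longlonglongrightarrow> 1 / qpoch_inf a q"
    by (intro tendsto_intros LIMSEQ_qpoch assms qpoch_inf_nonzero)
  thus ?thesis by (intro convergent_imp_Bseq convergentI)
qed

lemma Bseq_qpoch_quotient:
  assumes "norm b < 1" "norm q < 1"
  shows "Bseq (\<lambda>n. qpoch a q n / qpoch b q n)"
  using Bseq_mult[OF Bseq_qpoch[OF assms(2), of a] Bseq_inverse_qpoch[OF assms]] by simp

section \<open>Finite expansions of the Rogers polynomials\<close>

text \<open>
  Induction by the \<open>q\<close>-Pascal rule, which for sums with the denominators \<open>(q; q)\<^sub>m (q; q)\<^bsub>N-m\<^esub>\<close> takes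
  the form \<open>1 - q\<^bsup>N+1\<^esup> = (1 - q\<^bsup>N+1-m\<^esup>) + q\<^bsup>N+1-m\<^esup> (1 - q\<^sup>m)\<close>: the factor \<open>1 - q\<^bsup>N+1-m\<^esup>\<close> lowers one of
  the denominators, the factor \<open>1 - q\<^sup>m\<close> the other, and the two resulting sums over \<open>m \<le> N\<close> combine
  to \<open>1 - A b q\<^sup>N\<close> times the previous sum. With the other \<open>q\<close>-Pascal rule the combined factor would
  depend on \<open>m\<close>.
\<close>

lemma q_Vandermonde:
  assumes "norm q < 1"
  shows "(\<Sum>m\<le>N. qpoch A q m * qpoch b q (N - m) * b ^ m / (qpoch q q m * qpoch q q (N - m)))
         = qpoch (A * b) q N / qpoch q q N"
proof (induction N)
  case (Suc N)
  let ?T = "\<lambda>N m. qpoch A q m * qpoch b q (N - m) * b ^ m / (qpoch q q m * qpoch q q (N - m))"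
  have nz: "qpoch q q k \<noteq> 0" for k using assms by (simp add: qpoch_nonzero)
  have nz1: "1 - q * q ^ k \<noteq> 0" for k using nz[of "Suc k"] by (simp add: qpoch_Suc)
  have "(1 - q ^ Suc N) * (\<Sum>m\<le>Suc N. ?T (Suc N) m)
      = (\<Sum>m\<le>Suc N. (1 - q ^ (Suc N - m)) * ?T (Suc N) m + q ^ (Suc N - m) * (1 - q ^ m) * ?T (Suc N) m)"
    unfolding sum_distrib_left
  proof (rule sum.cong)
    fix m assume "m \<in> {..Suc N}"
    then have "q ^ Suc N = q ^ (Suc N - m) * q ^ m" by (simp flip: power_add)
    then have "1 - q ^ Suc N = (1 - q ^ (Suc N - m)) + q ^ (Suc N - m) * (1 - q ^ m)"
      by (simp add: algebra_simps)
    then show "(1 - q ^ Suc N) * ?T (Suc N) m = (1 - q ^ (Suc N - m)) * ?T (Suc N) m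
          + q ^ (Suc N - m) * (1 - q ^ m) * ?T (Suc N) m"
      by (simp only: distrib_right)
  qed simp
  also have "\<dots> = (\<Sum>m\<le>Suc N. (1 - q ^ (Suc N - m)) * ?T (Suc N) m)
      + (\<Sum>m\<le>Suc N. q ^ (Suc N - m) * (1 - q ^ m) * ?T (Suc N) m)"
    by (rule sum.distrib)
  also have "(\<Sum>m\<le>Suc N. (1 - q ^ (Suc N - m)) * ?T (Suc N) m) = (\<Sum>m\<le>N. (1 - b * q ^ (N - m)) * ?T N m)"
  proof -
    have "(1 - q ^ (Suc N - m)) * ?T (Suc N) m = (1 - b * q ^ (N - m)) * ?T N m" if "m \<le> N" for m
      using that nz nz1[of "N - m"] by (simp add: Suc_diff_le qpoch_Suc field_simps)
    then show ?thesis by simp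
  qed
  also have "(\<Sum>m\<le>Suc N. q ^ (Suc N - m) * (1 - q ^ m) * ?T (Suc N) m)
      = (\<Sum>m\<le>N. q ^ (N - m) * (1 - A * q ^ m) * b * ?T N m)"
  proof -
    have "q ^ (Suc N - Suc m) * (1 - q ^ Suc m) * ?T (Suc N) (Suc m)
        = q ^ (N - m) * (1 - A * q ^ m) * b * ?T N m" for m
      using nz nz1[of m] by (simp add: qpoch_Suc divide_simps)
    then show ?thesis by (subst sum.atMost_Suc_shift) simp
  qed
  also have "(\<Sum>m\<le>N. (1 - b * q ^ (N - m)) * ?T N m) + (\<Sum>m\<le>N. q ^ (N - m) * (1 - A * q ^ m) * b * ?T N m)
      = (1 - A * b * q ^ N) * (\<Sum>m\<le>N. ?T N m)"
    unfolding sum_distrib_left sum.distrib[symmetric]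
  proof (rule sum.cong)
    fix m assume "m \<in> {..N}"
    then have "q ^ N = q ^ (N - m) * q ^ m" by (simp flip: power_add)
    then have "(1 - b * q ^ (N - m)) + q ^ (N - m) * (1 - A * q ^ m) * b = 1 - A * b * q ^ N"
      by (simp add: algebra_simps)
    then show "(1 - b * q ^ (N - m)) * ?T N m + q ^ (N - m) * (1 - A * q ^ m) * b * ?T N m
        = (1 - A * b * q ^ N) * ?T N m"
      by (simp only: distrib_right[symmetric])
  qed simp
  finally have "(\<Sum>m\<le>Suc N. ?T (Suc N) m) = (1 - A * b * q ^ N) * (\<Sum>m\<le>N. ?T N m) / (1 - q * q ^ N)"
    using nz1[of N] by (simp only: eq_divide_eq power_Suc mult.commute) simp
  then show ?case
    by (simp only: Suc.IH qpoch_Suc times_divide_eq_right divide_divide_eq_left) (simp add: mult_ac)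
qed simp

text \<open>
  The homogeneous form \<open>w\<^sup>n (c/w; q)\<^sub>n\<close> of the shifted factorial. It is a polynomial in \<open>w\<close>, so the
  finite identities below need no case distinction for \<open>w = 0\<close>.
\<close>

definition qpoch_hom :: "complex \<Rightarrow> complex \<Rightarrow> complex \<Rightarrow> nat \<Rightarrow> complex" where
  "qpoch_hom w c q n = (\<Prod>j<n. w - c * q ^ j)"

lemma qpoch_hom_0 [simp]: "qpoch_hom w c q 0 = 1" by (simp add: qpoch_hom_def)
lemma qpoch_hom_Suc: "qpoch_hom w c q (Suc n) = qpoch_hom w c q n * (w - c * q ^ n)"
  by (simp add: qpoch_hom_def)

lemma qpoch_hom_eq: "w \<noteq> 0 \<Longrightarrow> qpoch_hom w c q n = w ^ n * qpoch (c / w) q n"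
  by (induction n) (simp_all add: qpoch_hom_Suc qpoch_Suc field_simps)

text \<open>
  Cauchy's expansion of a power in the Newton basis at the nodes \<open>c, c q, c q\<^sup>2, \<dots>\<close>. The induction
  multiplies by \<open>w = (w - c q\<^sup>j) + c q\<^sup>j\<close>, with the \<open>q\<close>-Pascal rule again providing the splitting.
\<close>

lemma power_eq_sum_qpoch_hom:
  assumes "norm q < 1"
  shows "w ^ N / qpoch q q N = (\<Sum>j\<le>N. qpoch_hom w c q j * c ^ (N - j) / (qpoch q q j * qpoch q q (N - j)))"
proof (induction N)
  case (Suc N)
  let ?T = "\<lambda>N j. qpoch_hom w c q j * c ^ (N - j) / (qpoch q q j * qpoch q q (N - j))"
  have nz: "qpoch q q k \<noteq> 0" for k using assms by (simp add: qpoch_nonzero)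
  have nz1: "1 - q * q ^ k \<noteq> 0" for k using nz[of "Suc k"] by (simp add: qpoch_Suc)
  have "(1 - q ^ Suc N) * (\<Sum>m\<le>Suc N. ?T (Suc N) m)
      = (\<Sum>m\<le>Suc N. (1 - q ^ m) * ?T (Suc N) m + q ^ m * (1 - q ^ (Suc N - m)) * ?T (Suc N) m)"
    unfolding sum_distrib_left
  proof (rule sum.cong)
    fix m assume "m \<in> {..Suc N}"
    then have "q ^ Suc N = q ^ (Suc N - m) * q ^ m" by (simp flip: power_add)
    then have "1 - q ^ Suc N = (1 - q ^ m) + q ^ m * (1 - q ^ (Suc N - m))"
      by (simp add: algebra_simps)
    then show "(1 - q ^ Suc N) * ?T (Suc N) m = (1 - q ^ m) * ?T (Suc N) m
          + q ^ m * (1 - q ^ (Suc N - m)) * ?T (Suc N) m"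
      by (simp only: distrib_right)
  qed simp
  also have "\<dots> = (\<Sum>m\<le>Suc N. (1 - q ^ m) * ?T (Suc N) m)
      + (\<Sum>m\<le>Suc N. q ^ m * (1 - q ^ (Suc N - m)) * ?T (Suc N) m)"
    by (rule sum.distrib)
  also have "(\<Sum>m\<le>Suc N. (1 - q ^ m) * ?T (Suc N) m) = (\<Sum>m\<le>N. (w - c * q ^ m) * ?T N m)"
  proof -
    have "(1 - q ^ Suc m) * ?T (Suc N) (Suc m) = (w - c * q ^ m) * ?T N m" for m
      using nz nz1[of m] by (simp add: qpoch_Suc qpoch_hom_Suc divide_simps)
    then show ?thesis by (subst sum.atMost_Suc_shift) simp
  qed
  also have "(\<Sum>m\<le>Suc N. q ^ m * (1 - q ^ (Suc N - m)) * ?T (Suc N) m) = (\<Sum>m\<le>N. c * q ^ m * ?T N m)"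
  proof -
    have "q ^ m * (1 - q ^ (Suc N - m)) * ?T (Suc N) m = c * q ^ m * ?T N m" if "m \<le> N" for m
      using that nz nz1[of "N - m"] by (simp add: Suc_diff_le qpoch_Suc divide_simps)
    then show ?thesis by simp
  qed
  also have "(\<Sum>m\<le>N. (w - c * q ^ m) * ?T N m) + (\<Sum>m\<le>N. c * q ^ m * ?T N m)
      = w * (\<Sum>m\<le>N. ?T N m)"
    unfolding sum_distrib_left sum.distrib[symmetric]
    by (simp only: distrib_right[symmetric] diff_add_cancel)
  finally have "(\<Sum>m\<le>Suc N. ?T (Suc N) m) = w * (\<Sum>m\<le>N. ?T N m) / (1 - q * q ^ N)"
    using nz1[of N] by (simp only: eq_divide_eq power_Suc mult.commute) simp
  also have "\<dots> = w ^ Suc N / qpoch q q (Suc N)"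
    by (simp only: Suc.IH[symmetric] qpoch_Suc times_divide_eq_right divide_divide_eq_left power_Suc)
  finally show ?case by (rule sym)
qed simp

text \<open>
  The Rogers polynomial as a homogeneous polynomial in two variables: at \<open>u = e\<^bsup>i\<theta>\<^esup>\<close>, \<open>v = e\<^bsup>-i\<theta>\<^esup>\<close> it is
  \<open>C\<^sub>n(cos \<theta>; b | q)\<close>. Two independent variables turn the identities between Rogers polynomials
  into comparisons of coefficients.
\<close>

definition rogers_hom :: "complex \<Rightarrow> complex \<Rightarrow> complex \<Rightarrow> complex \<Rightarrow> nat \<Rightarrow> complex" where
  "rogers_hom u v b q n =
     (\<Sum>j\<le>n. qpoch b q j * qpoch b q (n - j) / (qpoch q q j * qpoch q q (n - j)) * u ^ (n - j) * v ^ j)"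

text \<open>
  The coefficients of the generating function. Expanding \<open>v\<^sup>j\<close> in the Newton basis at the nodes
  \<open>b u q\<^sup>i\<close> and summing over \<open>j\<close> first leaves a \<open>q\<close>-Vandermonde sum. For the
  generating functions over \<open>n\<close> it becomes an instance of the \<open>q\<close>-Gauss summation.
\<close>

lemma rogers_hom_eq_sum_qpoch_hom:
  assumes "norm q < 1"
  shows "rogers_hom u v b q n =
     (\<Sum>k\<le>n. qpoch b q k * qpoch (b\<^sup>2 * q ^ k) q (n - k) / (qpoch q q k * qpoch q q (n - k))
            * qpoch_hom v (b * u) q k * u ^ (n - k))"
proof -
  let ?P = "\<lambda>k. qpoch q q k"
  let ?F = "\<lambda>k m. qpoch b q (k + m) * qpoch b q (n - (k + m)) / ?P (n - (k + m)) * u ^ (n - (k + m))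
                  * (qpoch_hom v (b * u) q k * (b * u) ^ m / (?P k * ?P m))"
  have "rogers_hom u v b q n =
      (\<Sum>j\<le>n. qpoch b q j * qpoch b q (n - j) / ?P (n - j) * u ^ (n - j) * (v ^ j / ?P j))"
    by (simp add: rogers_hom_def mult_ac)
  also have "\<dots> = (\<Sum>j\<le>n. \<Sum>k\<le>j. ?F k (j - k))"
    unfolding power_eq_sum_qpoch_hom[OF assms, of v _ "b * u"] sum_distrib_left
    by (intro sum.cong) auto
  also have "\<dots> = (\<Sum>k\<le>n. \<Sum>m\<le>n - k. ?F k m)"
    by (simp add: sum.Sigma)
      (rule sum.reindex_bij_witness[of _ "\<lambda>(k, m). (k + m, k)" "\<lambda>(j, k). (k, j - k)"]; auto)
  also have "\<dots> = (\<Sum>k\<le>n. qpoch b q k * qpoch_hom v (b * u) q k / ?P k * u ^ (n - k)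
        * (\<Sum>m\<le>n - k. qpoch (b * q ^ k) q m * qpoch b q (n - k - m) * b ^ m / (?P m * ?P (n - k - m))))"
    unfolding sum_distrib_left
  proof (intro sum.cong refl)
    fix k m assume "k \<in> {..n}" "m \<in> {..n - k}"
    then have "u ^ (n - k) = u ^ (n - (k + m)) * u ^ m" by (simp flip: power_add)
    then show "?F k m = qpoch b q k * qpoch_hom v (b * u) q k / ?P k * u ^ (n - k)
        * (qpoch (b * q ^ k) q m * qpoch b q (n - k - m) * b ^ m / (?P m * ?P (n - k - m)))"
      by (simp add: qpoch_add power_mult_distrib mult_ac)
  qed
  also have "\<dots> = (\<Sum>k\<le>n. qpoch b q k * qpoch (b\<^sup>2 * q ^ k) q (n - k) / (?P k * ?P (n - k))
            * qpoch_hom v (b * u) q k * u ^ (n - k))"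
    by (simp only: q_Vandermonde[OF assms]) (simp add: power2_eq_square mult_ac)
  finally show ?thesis .
qed

section \<open>The connection formula of Rogers\<close>

text \<open>
  What remains of the telescoping step in the next lemma after the common factors are divided out,
  with \<open>K\<close>, \<open>I\<close>, \<open>R\<close> standing for \<open>q\<^sup>k\<close>, \<open>q\<^sup>i\<close>, \<open>q\<^sup>r\<close>.
\<close>

lemma telescoping_polynomial_identity:
  fixes K I R a b q :: complex
  shows "(1 - K * I * q) * ((1 - b * (K * I * R * q)) * (1 - a * (I * R * q * q)) * (1 - a * I))
          - (1 - b * (K * I)) * ((1 - a * (I * R * q)) * (1 - a * (K * I * R * q * q)) * (1 - q * I))
        = I * q * (1 - K) * (1 - b * (K * I * R * q)) * (1 - a * I) * (1 - a * (R * q))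
          - I * (a - b * K) * (1 - a * (K * I * R * q * q)) * (1 - q * I) * (1 - q * R)"
  by (simp add: algebra_simps)

text \<open>
  The coefficient of \<open>u\<^sup>N v\<^sup>j\<close> in Rogers' connection formula; up to reversing factors it is the
  terminating very-well-poised \<open>\<^sub>6\<phi>\<^sub>5\<close> summation. The proof is by induction on \<open>j\<close> and
  creative telescoping. For the summand \<open>U j k\<close>, the combination
  \<open>(1 - q\<^bsup>j+1\<^esup>) U (j + 1) k - (1 - b q\<^sup>j) U j k\<close> is a difference \<open>V k - V (k + 1)\<close> of the explicit
  term \<open>V\<close>, which vanishes at \<open>k = 0\<close> and at \<open>k = j + 1\<close> cancels the one summand
  of the new sum that the old sum lacks. So both sides satisfy the same recurrence in \<open>j\<close>.
\<close>

lemma connection_coefficient_identity: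
  fixes a b q :: complex
  assumes q: "norm q < 1" and a: "norm a < 1" and "j \<le> N"
  shows "(\<Sum>k\<le>j. qpoch_hom a b q k * qpoch b q (j + N - k) * (1 - a * q ^ (j + N - 2 * k))
            * qpoch a q (j - k) * qpoch a q (N - k)
            / (qpoch q q k * qpoch a q (j + N - k + 1) * qpoch q q (j - k) * qpoch q q (N - k)))
         = qpoch b q j * qpoch b q N / (qpoch q q j * qpoch q q N)"
  using \<open>j \<le> N\<close>
proof (induction j)
  case 0
  have A: "qpoch a q (Suc N) \<noteq> 0" using a q by (simp add: qpoch_nonzero)
  have "qpoch b q N * (1 - a * q ^ N) * qpoch a q N / (qpoch a q (Suc N) * qpoch q q N)
      = qpoch b q N * qpoch a q (Suc N) / (qpoch a q (Suc N) * qpoch q q N)"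
    by (simp add: qpoch_Suc)
  also have "\<dots> = qpoch b q N / qpoch q q N" using A by simp
  finally show ?case by simp
next
  case (Suc j)
  let ?P = "\<lambda>k. qpoch q q k" and ?A = "\<lambda>k. qpoch a q k"
  define U where "U = (\<lambda>j k. qpoch_hom a b q k * qpoch b q (j + N - k) * (1 - a * q ^ (j + N - 2 * k))
            * ?A (j - k) * ?A (N - k) / (?P k * ?A (j + N - k + 1) * ?P (j - k) * ?P (N - k)))"
  define V where "V = (\<lambda>k. q ^ (j + 1 - k) * (1 - q ^ k) * qpoch_hom a b q k * qpoch b q (j + N + 1 - k)
            * ?A (j + 1 - k) * ?A (N + 1 - k)
            / (?P k * ?A (j + N + 2 - k) * ?P (j + 1 - k) * ?P (N - k)))"
  have P: "?P k \<noteq> 0" for k using q by (simp add: qpoch_nonzero)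
  have A: "?A k \<noteq> 0" for k using q a by (simp add: qpoch_nonzero)
  have P1: "1 - q * q ^ k \<noteq> 0" for k using P[of "Suc k"] by (simp add: qpoch_Suc)
  have A1: "1 - a * q ^ k \<noteq> 0" for k using A[of "Suc k"] by (simp add: qpoch_Suc)
  have step: "(1 - q ^ Suc j) * U (Suc j) k - (1 - b * q ^ j) * U j k = V k - V (Suc k)"
    if kj: "k \<le> j" for k
  proof -
    obtain i where i: "j = k + i" using le_Suc_ex[OF kj] by blast
    obtain r where r: "N = k + 1 + r" using kj Suc.prems le_Suc_ex[of "k + 1" N]
      by (metis Suc_eq_plus1 Suc_le_mono le_trans)
    \<comment> \<open>Writing \<open>j = k + i\<close> and \<open>N = k + 1 + r\<close> removes every truncated subtraction.\<close>
    define s where "s = k + i + r + 1"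
    define C where "C = qpoch_hom a b q k * qpoch b q s * ?A i * ?A (Suc r)
         / (?P k * ?A (Suc (Suc s)) * ?P (Suc i) * ?P (Suc r))"
    have arg: "Suc j + N - k = Suc s" "j + N - k = s" "Suc j + N - 2 * k = i + r + 2"
      "j + N - 2 * k = i + r + 1" "Suc j - k = Suc i" "j - k = i" "N - k = Suc r"
      "Suc j + N - k + 1 = Suc (Suc s)" "j + N - k + 1 = Suc s"
      "j + 1 - k = Suc i" "j + N + 1 - k = Suc s" "N + 1 - k = Suc (Suc r)"
      "j + N + 2 - k = Suc (Suc s)" "j + 1 - Suc k = i" "j + N + 1 - Suc k = s"
      "N + 1 - Suc k = Suc r" "j + N + 2 - Suc k = Suc s" "N - Suc k = r"
      by (simp_all add: i r s_def)
    \<comment> \<open>All four terms are multiples of the common factor \<open>C\<close>.\<close>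
    have U1: "U (Suc j) k = C * ((1 - b * q ^ s) * (1 - a * q ^ (i + r + 2)) * (1 - a * q ^ i))"
      unfolding U_def C_def arg by (simp add: qpoch_Suc)
    have U2: "U j k = C * ((1 - a * q ^ (i + r + 1)) * (1 - a * q ^ Suc s) * (1 - q * q ^ i))"
      unfolding U_def C_def arg using P P1 A A1 A1[of "Suc s"] by (simp add: qpoch_Suc divide_simps)
    have V1: "V k = C * (q ^ Suc i * (1 - q ^ k) * (1 - b * q ^ s) * (1 - a * q ^ i) * (1 - a * q ^ Suc r))"
      unfolding V_def C_def arg by (simp add: qpoch_Suc)
    have V2: "V (Suc k) = C * (q ^ i * (a - b * q ^ k) * (1 - a * q ^ Suc s) * (1 - q * q ^ i) * (1 - q * q ^ r))"
      unfolding V_def C_def arg using P P1 A A1 A1[of "Suc s"] by (simp add: qpoch_Suc qpoch_hom_Suc divide_simps)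
    have pw: "q ^ Suc (k + i) = q ^ k * q ^ i * q" "q ^ (k + i) = q ^ k * q ^ i"
      "q ^ s = q ^ k * q ^ i * q ^ r * q" "q ^ Suc s = q ^ k * q ^ i * q ^ r * q * q"
      "q ^ (i + r + 2) = q ^ i * q ^ r * q * q" "q ^ (i + r + 1) = q ^ i * q ^ r * q"
      "q ^ Suc i = q ^ i * q" "q ^ Suc r = q ^ r * q"
      by (simp_all add: s_def power_add power2_eq_square)
    have factor: "x * (C * X) - y * (C * Y) = C * (x * X - y * Y)" "C * X - C * Y = C * (X - Y)"
      for x y X Y by (simp_all add: algebra_simps)
    show ?thesis
      unfolding U1 U2 V1 V2 unfolding i pw factor by (rule arg_cong[OF telescoping_polynomial_identity])
  qed
  have "(1 - q ^ Suc j) * (\<Sum>k\<le>j. U (Suc j) k) - (1 - b * q ^ j) * (\<Sum>k\<le>j. U j k) = (\<Sum>k\<le>j. V k - V (Suc k))"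
    unfolding sum_distrib_left sum_subtractf[symmetric] by (intro sum.cong refl step) simp
  also have "\<dots> = V 0 - V (Suc j)" by (rule sum_telescope)
  also have "V 0 = 0" by (simp add: V_def)
  also have "V (Suc j) = (1 - q ^ Suc j) * U (Suc j) (Suc j)"
  proof -
    obtain r where r: "N = Suc j + r" using le_Suc_ex[OF Suc.prems] by blast
    have arg: "j + 1 - Suc j = 0" "j + N + 1 - Suc j = N" "N + 1 - Suc j = Suc r"
      "j + N + 2 - Suc j = Suc N" "Suc j + N - Suc j = N" "Suc j + N - 2 * Suc j = r"
      "Suc j - Suc j = 0" "N - Suc j = r" "N + 1 = Suc N" "Suc N - Suc j = Suc r"
      by (simp_all add: r)
    show ?thesis unfolding U_def V_def arg by (simp add: qpoch_Suc)
  qed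
  finally have "(1 - q ^ Suc j) * (\<Sum>k\<le>Suc j. U (Suc j) k) = (1 - b * q ^ j) * (\<Sum>k\<le>j. U j k)"
    unfolding sum.atMost_Suc distrib_left by (simp only: diff_eq_eq diff_0 uminus_add_conv_diff eq_diff_eq)
  also have "(\<Sum>k\<le>j. U j k) = qpoch b q j * qpoch b q N / (?P j * ?P N)"
    unfolding U_def using Suc by simp
  finally have "(\<Sum>k\<le>Suc j. U (Suc j) k)
      = (1 - b * q ^ j) * (qpoch b q j * qpoch b q N / (?P j * ?P N)) / (1 - q * q ^ j)"
    using P1[of j] by (simp only: eq_divide_eq power_Suc mult.commute) simp
  then show ?case unfolding U_def
    by (simp only: qpoch_Suc times_divide_eq_right divide_divide_eq_left mult_ac)
qed

text \<open>
  Rogers' connection formula between the parameters \<open>b\<close> and \<open>a\<close>. The coefficients of \<open>u\<^bsup>n-j\<^esup> v\<^sup>j\<close> on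
  both sides agree by the preceding identity, applied to \<open>j \<le> n - j\<close> or with \<open>j\<close> and \<open>n - j\<close>
  exchanged.
\<close>

lemma rogers_hom_connection:
  assumes q: "norm q < 1" and a: "norm a < 1"
  shows "rogers_hom u v b q n =
     (\<Sum>k | 2 * k \<le> n. qpoch_hom a b q k * qpoch b q (n - k) * (1 - a * q ^ (n - 2 * k))
            / (qpoch q q k * qpoch a q (n - k + 1)) * (u * v) ^ k * rogers_hom u v a q (n - 2 * k))"
proof -
  let ?P = "\<lambda>k. qpoch q q k" and ?A = "\<lambda>k. qpoch a q k"
  define W where "W = (\<lambda>k. qpoch_hom a b q k * qpoch b q (n - k) * (1 - a * q ^ (n - 2 * k))
      / (?P k * ?A (n - k + 1)))"
  have coeff: "qpoch b q j * qpoch b q (n - j) / (?P j * ?P (n - j))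
      = (\<Sum>k\<le>min j (n - j). W k * (?A (j - k) * ?A (n - j - k) / (?P (j - k) * ?P (n - j - k))))"
    if "j \<le> n" for j
  proof (cases "j \<le> n - j")
    case True
    then have "min j (n - j) = j" by simp
    then show ?thesis
      using connection_coefficient_identity[OF q a True, of b] that by (simp add: W_def mult_ac)
  next
    case False
    then have "n - j \<le> j" "min j (n - j) = n - j" by simp_all
    then show ?thesis
      using connection_coefficient_identity[OF q a \<open>n - j \<le> j\<close>, of b] that by (simp add: W_def mult_ac)
  qed
  have "rogers_hom u v b q n
      = (\<Sum>j\<le>n. \<Sum>k\<le>min j (n - j). W k * (?A (j - k) * ?A (n - j - k) / (?P (j - k) * ?P (n - j - k)))
           * u ^ (n - j) * v ^ j)"
    unfolding rogers_hom_def by (intro sum.cong refl) (simp add: coeff sum_distrib_right)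
  also have "\<dots> = (\<Sum>k | 2 * k \<le> n. \<Sum>i\<le>n - 2 * k. W k * (?A i * ?A (n - (i + k) - k) / (?P i * ?P (n - (i + k) - k)))
           * u ^ (n - (i + k)) * v ^ (i + k))"
  proof -
    have fin: "finite {k. 2 * k \<le> n}" by (rule finite_subset[of _ "{..n}"]) auto
    show ?thesis
      by (simp add: sum.Sigma fin)
        (rule sum.reindex_bij_witness[of _ "\<lambda>(k, i). (i + k, k)" "\<lambda>(j, k). (k, j - k)"]; auto)
  qed
  also have "\<dots> = (\<Sum>k | 2 * k \<le> n. W k * (u * v) ^ k * rogers_hom u v a q (n - 2 * k))"
    unfolding rogers_hom_def sum_distrib_left
  proof (intro sum.cong refl)
    fix k i assume "k \<in> {k. 2 * k \<le> n}" "i \<in> {..n - 2 * k}"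
    then have e: "n - (i + k) - k = n - 2 * k - i" "n - (i + k) = (n - 2 * k - i) + k" by auto
    show "W k * (?A i * ?A (n - (i + k) - k) / (?P i * ?P (n - (i + k) - k))) * u ^ (n - (i + k)) * v ^ (i + k)
        = W k * (u * v) ^ k * (?A i * ?A (n - 2 * k - i) / (?P i * ?P (n - 2 * k - i)) * u ^ (n - 2 * k - i) * v ^ i)"
      unfolding e by (simp add: power_add power_mult_distrib mult_ac)
  qed
  finally show ?thesis unfolding W_def .
qed

section \<open>Fourier form of the Rogers polynomials\<close>

text \<open>
  Reversing the order of the factors in the two shifted factorials that depend on \<open>n\<close>. This turns
  the terminating \<open>\<^sub>2\<phi>\<^sub>1\<close> that defines the Rogers polynomial into its symmetric Fourier expansion.
\<close>

lemma qpoch_reversal: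
  assumes "q \<noteq> 0" "norm q < 1" "b \<noteq> 0" "norm b < 1" "k \<le> n"
  shows "qpoch (q powi (- int n)) q k / qpoch (inverse b * q powi (1 - int n)) q k * (q * inverse b) ^ k
         = qpoch q q n * qpoch b q (n - k) / (qpoch q q (n - k) * qpoch b q n)"
  using \<open>k \<le> n\<close>
proof (induction k)
  case 0
  show ?case using assms by (simp add: qpoch_nonzero)
next
  case (Suc k)
  obtain m where m: "n = Suc k + m" using le_Suc_ex[OF Suc.prems] by blast
  have nk: "n - k = Suc m" "n - Suc k = m" by (simp_all add: m)
  have P: "qpoch q q i \<noteq> 0" "qpoch b q i \<noteq> 0" for i using assms by (simp_all add: qpoch_nonzero)
  have P1: "1 - q * q ^ m \<noteq> 0" "1 - b * q ^ m \<noteq> 0" using P[of "Suc m"] by (simp_all add: qpoch_Suc)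
  have pw: "q powi (- int n) * q ^ k = 1 / (q * q ^ m)" "q powi (1 - int n) * q ^ k = 1 / q ^ m"
    using \<open>q \<noteq> 0\<close> by (simp_all add: m power_int_diff power_int_minus power_int_add field_simps)
  have ratio: "(1 - 1 / (q * q ^ m)) / (1 - inverse b * (1 / q ^ m)) * (q * inverse b)
      = (1 - q * q ^ m) / (1 - b * q ^ m)"
  proof -
    have "(1 - 1 / (q * q ^ m)) * (q * inverse b) = - (1 - q * q ^ m) / (b * q ^ m)"
      using assms by (simp add: field_simps)
    moreover have "1 - inverse b * (1 / q ^ m) = - (1 - b * q ^ m) / (b * q ^ m)"
      using assms by (simp add: field_simps)
    ultimately show ?thesis using assms P1 by (simp add: field_simps)
  qed
  have regroup: "(X * x) / (Y * y) * (z * Z) = (X / Y * Z) * (x / y * z)" for X x Y y z Z :: complex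
    by simp
  have "qpoch (q powi (- int n)) q (Suc k) / qpoch (inverse b * q powi (1 - int n)) q (Suc k) * (q * inverse b) ^ Suc k
      = (qpoch (q powi (- int n)) q k / qpoch (inverse b * q powi (1 - int n)) q k * (q * inverse b) ^ k)
        * ((1 - q * q ^ m) / (1 - b * q ^ m))"
    by (simp only: qpoch_Suc power_Suc regroup mult.assoc[of "inverse b"] pw ratio)
  also have "\<dots> = qpoch q q n * qpoch b q (Suc m) / (qpoch q q (Suc m) * qpoch b q n)
        * ((1 - q * q ^ m) / (1 - b * q ^ m))"
    using Suc nk by simp
  also have "\<dots> = qpoch q q n * qpoch b q m / (qpoch q q m * qpoch b q n)"
    using P P1 by (simp add: qpoch_Suc divide_simps)
  finally show ?case unfolding nk .
qed

text \<open>
  The \<open>\<^sub>2\<phi>\<^sub>1\<close> form singles out the leading exponential \<open>e\<^bsup>in\<theta>\<^esup>\<close>; after reversal of the factors its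
  terms are those of the symmetric sum.
\<close>

lemma rogers_eq_rogers_hom:
  assumes "q \<noteq> 0" "norm q < 1" "b \<noteq> 0" "norm b < 1" "0 \<le> \<theta>" "\<theta> \<le> pi"
  shows "rogers n (cos \<theta>) b q = rogers_hom (cis \<theta>) (cis (- \<theta>)) b q n"
proof -
  let ?as = "[q powi (- int n), b]" and ?bs = "[inverse b * q powi (1 - int n)]"
  let ?z = "q * inverse b * cis (- 2 * \<theta>)"
  have P: "qpoch q q i \<noteq> 0" "qpoch b q i \<noteq> 0" for i using assms by (simp_all add: qpoch_nonzero)
  have term_eq: "qhyp_term ?as ?bs q ?z k
      = qpoch q q n / qpoch b q n * (qpoch b q k * qpoch b q (n - k) / (qpoch q q k * qpoch q q (n - k)) * cis (- 2 * \<theta>) ^ k)"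
    if "k \<le> n" for k
  proof -
    have "qhyp_term ?as ?bs q ?z k = (qpoch (q powi (- int n)) q k / qpoch (inverse b * q powi (1 - int n)) q k
        * (q * inverse b) ^ k) * (qpoch b q k / qpoch q q k * cis (- 2 * \<theta>) ^ k)"
      unfolding qhyp_term_def power_mult_distrib by (simp add: qpochs_def mult_ac)
    then show ?thesis unfolding qpoch_reversal[OF assms(1-4) that] by (simp only: times_divide_times_eq mult_ac)
  qed
  have zero: "qhyp_term ?as ?bs q ?z k = 0" if "k \<notin> {..n}" for k
  proof -
    have "q powi (- int n) * q ^ n = 1" using assms by (simp add: power_int_minus)
    then have "qpoch (q powi (- int n)) q k = 0" using that unfolding qpoch_eq_0_iff by (intro exI[of _ n]) simp
    then show ?thesis by (simp add: qhyp_term_def qpochs_def)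
  qed
  have "qhyp ?as ?bs q ?z = (\<Sum>k\<le>n. qhyp_term ?as ?bs q ?z k)"
    unfolding qhyp_def by (rule suminf_finite) (use zero in auto)
  also have "\<dots> = qpoch q q n / qpoch b q n
      * (\<Sum>k\<le>n. qpoch b q k * qpoch b q (n - k) / (qpoch q q k * qpoch q q (n - k)) * cis (- 2 * \<theta>) ^ k)"
    unfolding sum_distrib_left by (intro sum.cong refl term_eq) simp
  finally have "rogers n (cos \<theta>) b q
      = cis (real n * \<theta>) * (\<Sum>k\<le>n. qpoch b q k * qpoch b q (n - k) / (qpoch q q k * qpoch q q (n - k)) * cis (- 2 * \<theta>) ^ k)"
    using P assms by (simp add: rogers_def Let_def arccos_cos)
  also have "\<dots> = rogers_hom (cis \<theta>) (cis (- \<theta>)) b q n"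
    unfolding rogers_hom_def sum_distrib_left
  proof (intro sum.cong refl)
    fix k assume "k \<in> {..n}"
    then have "cis (real n * \<theta>) * cis (- 2 * \<theta>) ^ k = cis \<theta> ^ (n - k) * cis (- \<theta>) ^ k"
      by (simp add: Complex.DeMoivre cis_mult of_nat_diff algebra_simps)
    then show "cis (real n * \<theta>) * (qpoch b q k * qpoch b q (n - k) / (qpoch q q k * qpoch q q (n - k)) * cis (- 2 * \<theta>) ^ k)
        = qpoch b q k * qpoch b q (n - k) / (qpoch q q k * qpoch q q (n - k)) * cis \<theta> ^ (n - k) * cis (- \<theta>) ^ k"
      by (simp only: mult.assoc mult.left_commute[of "cis (real n * \<theta>)"])
  qed
  finally show ?thesis .
qed

section \<open>The generating function\<close>

text \<open>
  Rearrangement of a double series: a product majorant makes it absolutely summable, so it may be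
  summed by rows or along the lines \<open>m + d k = n\<close>. Slope \<open>d = 1\<close> serves the generating function and
  \<open>d = 2\<close> the connection formula, where the degree drops in steps of two.
\<close>

lemma sum_rows_eq_sum_diagonals:
  fixes f :: "nat \<Rightarrow> nat \<Rightarrow> complex"
  assumes "summable A" "summable B" "\<And>m. 0 \<le> A m" "\<And>k. 0 \<le> B k"
    and bound: "\<And>m k. norm (f m k) \<le> A m * B k"
    and "0 < d"
  shows "summable (\<lambda>m. \<Sum>k. f m k)"
    and "(\<lambda>n. \<Sum>k | d * k \<le> n. f (n - d * k) k) sums (\<Sum>m. \<Sum>k. f m k)"
proof -
  have "A summable_on UNIV" "B summable_on UNIV"
    using assms by (simp_all add: summable_on_UNIV_nonneg_real_iff)
  then have "(\<lambda>(m, k). A m * B k) summable_on UNIV \<times> UNIV"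
    using assms(3,4) by (intro summable_on_SigmaI[where g = "\<lambda>m. A m * infsum B UNIV"])
      (auto intro!: has_sum_cmult_right summable_on_cmult_left)
  then have "(\<lambda>x. norm (case x of (m, k) \<Rightarrow> f m k)) summable_on UNIV \<times> UNIV"
    by (rule Infinite_Sum.abs_summable_on_comparison_test') (use bound in auto)
  then obtain T where T: "((\<lambda>(m, k). f m k) has_sum T) (UNIV \<times> UNIV)"
    using abs_summable_summable summable_on_def by blast
  have row: "(f m has_sum (\<Sum>k. f m k)) UNIV" for m
  proof (rule norm_summable_imp_has_sum)
    show sm: "summable (\<lambda>k. norm (f m k))"
      by (rule summable_comparison_test'[OF summable_mult[OF assms(2), of "A m"], of 0]) (use bound in auto)
    show "f m sums (\<Sum>k. f m k)" using summable_norm_cancel[OF sm] by (rule summable_sums)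
  qed
  have 1: "(\<lambda>m. \<Sum>k. f m k) sums T"
    by (rule has_sum_imp_sums, rule has_sum_SigmaD[OF T]) (use row in auto)
  have "((\<lambda>(n, k). f (n - d * k) k) has_sum T) (SIGMA n:UNIV. {k. d * k \<le> n})"
    by (subst has_sum_reindex_bij_witness[where j = "\<lambda>(n, k). (n - d * k, k)" and i = "\<lambda>(m, k). (m + d * k, k)"
          and T = "UNIV \<times> UNIV" and h = "\<lambda>(m, k). f m k" and s' = T]) (use T in auto)
  moreover have "finite {k. d * k \<le> n}" for n
    by (rule finite_subset[of _ "{..n}"]) (use \<open>0 < d\<close> in \<open>auto intro: order_trans[rotated]\<close>)
  ultimately have "((\<lambda>n. \<Sum>k | d * k \<le> n. f (n - d * k) k) has_sum T) UNIV"
    by (elim has_sum_SigmaD) (auto intro: has_sum_finite)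
  then have 2: "(\<lambda>n. \<Sum>k | d * k \<le> n. f (n - d * k) k) sums T"
    by (rule has_sum_imp_sums)
  show "summable (\<lambda>m. \<Sum>k. f m k)" using 1 by (rule sums_summable)
  show "(\<lambda>n. \<Sum>k | d * k \<le> n. f (n - d * k) k) sums (\<Sum>m. \<Sum>k. f m k)"
    using 2 sums_unique[OF 1] by simp
qed

text \<open>
  The sum \<open>F\<close> of the series satisfies \<open>(1 - x) F(x) = (1 - a x) F(q x)\<close>, which is the recurrence
  between consecutive coefficients. Iterating moves the argument to \<open>u q\<^sup>n \<rightarrow> 0\<close>, where \<open>F\<close> is
  continuous with value \<open>1\<close>.
\<close>

lemma q_binomial_theorem:
  assumes q: "norm q < 1" and u: "norm u < 1"
  shows "(\<lambda>m. qpoch a q m / qpoch q q m * u ^ m) sums (qpoch_inf (a * u) q / qpoch_inf u q)"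
proof -
  define c where "c = (\<lambda>m. qpoch a q m / qpoch q q m)"
  define F where "F = (\<lambda>x. \<Sum>m. c m * x ^ m)"
  obtain B where B: "\<And>m. norm (c m) \<le> B"
    using Bseq_bound[OF Bseq_qpoch_quotient[OF q q, of a]] unfolding c_def by blast
  have sm: "summable (\<lambda>m. c m * x ^ m)" if "norm x < 1" for x
  proof (rule summable_comparison_test')
    show "summable (\<lambda>m. B * norm x ^ m)" using that by (intro summable_mult summable_geometric) simp
    show "norm (c m * x ^ m) \<le> B * norm x ^ m" for m
      using B by (simp add: norm_mult norm_power mult_right_mono)
  qed
  have c_Suc: "c (Suc m) * (1 - q ^ Suc m) = c m * (1 - a * q ^ m)" for m
    using qpoch_nonzero[OF q, of q "Suc m"] q by (simp add: c_def qpoch_Suc)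
  have functional: "(1 - x) * F x = (1 - a * x) * F (q * x)" if "norm x < 1" for x
  proof -
    have qx: "norm (q * x) < 1" using norm_mult_power_less_1[OF that, of q 1] q by (simp add: mult.commute)
    have s1: "(\<lambda>m. c m * x ^ m) sums F x" and s2: "(\<lambda>m. c m * (q * x) ^ m) sums F (q * x)"
      unfolding F_def using sm[OF that] sm[OF qx] by (simp_all add: summable_sums)
    have "(\<lambda>m. c m * x ^ m - c m * (q * x) ^ m) sums (F x - F (q * x))"
      by (rule sums_diff[OF s1 s2])
    then have "(\<lambda>m. c (Suc m) * x ^ Suc m - c (Suc m) * (q * x) ^ Suc m) sums (F x - F (q * x))"
      by (subst sums_Suc_iff) simp
    moreover have "c (Suc m) * x ^ Suc m - c (Suc m) * (q * x) ^ Suc m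
        = x * (c m * x ^ m) - a * x * (c m * (q * x) ^ m)" for m
    proof -
      have "c (Suc m) * x ^ Suc m - c (Suc m) * (q * x) ^ Suc m = c (Suc m) * (1 - q ^ Suc m) * x ^ Suc m"
        by (simp add: power_mult_distrib algebra_simps)
      then show ?thesis unfolding c_Suc by (simp add: power_mult_distrib algebra_simps)
    qed
    ultimately have "(\<lambda>m. x * (c m * x ^ m) - a * x * (c m * (q * x) ^ m)) sums (F x - F (q * x))" by simp
    moreover have "(\<lambda>m. x * (c m * x ^ m) - a * x * (c m * (q * x) ^ m)) sums (x * F x - a * x * F (q * x))"
      by (intro sums_diff sums_mult s1 s2)
    ultimately have "F x - F (q * x) = x * F x - a * x * F (q * x)" by (rule sums_unique2)
    then show ?thesis by (simp add: algebra_simps)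
  qed
  have iter: "qpoch u q n * F u = qpoch (a * u) q n * F (u * q ^ n)" for n
  proof (induction n)
    case (Suc n)
    have "norm (u * q ^ n) < 1" using norm_mult_power_less_1[OF u] q by simp
    note step = functional[OF this]
    have "qpoch u q (Suc n) * F u = qpoch u q n * F u * (1 - u * q ^ n)"
      by (simp add: qpoch_Suc)
    also have "\<dots> = qpoch (a * u) q n * ((1 - u * q ^ n) * F (u * q ^ n))"
      unfolding Suc by simp
    also have "\<dots> = qpoch (a * u) q (Suc n) * F (u * q ^ Suc n)"
      unfolding step by (simp add: qpoch_Suc mult_ac)
    finally show ?case .
  qed simp
  have "isCont F 0"
    unfolding F_def by (rule isCont_powser[where K = "1 / 2"]) (auto intro: sm)
  moreover have "(\<lambda>n. u * q ^ n) \<longlonglongrightarrow> 0" using LIMSEQ_power_zero[OF q] by (rule tendsto_mult_right_zero)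
  ultimately have "(\<lambda>n. F (u * q ^ n)) \<longlonglongrightarrow> F 0" by (rule isCont_tendsto_compose)
  moreover have "F 0 = 1" unfolding F_def powser_zero by (simp add: c_def)
  ultimately have "(\<lambda>n. qpoch (a * u) q n * F (u * q ^ n)) \<longlonglongrightarrow> qpoch_inf (a * u) q * 1"
    by (intro tendsto_mult LIMSEQ_qpoch q) simp
  moreover have "(\<lambda>n. qpoch u q n * F u) \<longlonglongrightarrow> qpoch_inf u q * F u"
    by (intro tendsto_intros LIMSEQ_qpoch q)
  ultimately have "qpoch_inf u q * F u = qpoch_inf (a * u) q"
    unfolding iter using LIMSEQ_unique by fastforce
  then have "F u = qpoch_inf (a * u) q / qpoch_inf u q"
    using qpoch_inf_nonzero[OF u q] by (simp add: field_simps)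
  then show ?thesis
    using summable_sums[OF sm[OF u]] unfolding F_def c_def by simp
qed

text \<open>
  The case \<open>\<alpha> = \<beta>\<close> of the theorem. The \<open>q\<close>-binomial theorem expands
  \<open>(\<gamma> t u q\<^sup>k; q)\<^sub>\<infinity> / (t u; q)\<^sub>\<infinity>\<close> in powers of \<open>t u\<close>, and \<open>(\<gamma>; q)\<^sub>k (\<gamma> q\<^sup>k; q)\<^sub>m = (\<gamma>; q)\<^bsub>k+m\<^esub>\<close>; so the
  coefficient of \<open>t\<^sup>n\<close> is \<open>(\<gamma>; q)\<^sub>n\<close> times a finite sum free of \<open>\<gamma>\<close>, evaluated by
  \<open>rogers_hom_eq_sum_qpoch_hom\<close>.
\<close>

lemma rogers_generating_function:
  assumes q: "norm q < 1" and b: "norm b < 1" and u: "norm u = 1" and v: "norm v = 1" and t: "norm t < 1"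
  shows "(\<lambda>n. qpoch \<gamma> q n / qpoch (b\<^sup>2) q n * rogers_hom u v b q n * t ^ n) sums
     ((\<Sum>k. qpoch_inf (\<gamma> * t * u * q ^ k) q * (qpoch \<gamma> q k * qpoch b q k * qpoch_hom v (b * u) q k
          / (qpoch q q k * qpoch (b\<^sup>2) q k)) * t ^ k) / qpoch_inf (t * u) q)"
proof -
  let ?P = "\<lambda>k. qpoch q q k" and ?D = "\<lambda>k. qpoch (b\<^sup>2) q k"
  define e where "e = (\<lambda>k. qpoch b q k * qpoch_hom v (b * u) q k / (?P k * ?D k))"
  define f where "f = (\<lambda>k m. qpoch \<gamma> q (k + m) * e k * (1 / ?P m) * t ^ k * (t * u) ^ m)"
  have b2: "norm (b\<^sup>2) < 1" using b by (simp add: norm_power power_less_one_iff abs_square_less_1)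
  have tu: "norm (t * u) < 1" using t u by (simp add: norm_mult)
  have nz: "?P k \<noteq> 0" "?D k \<noteq> 0" for k using q b2 by (simp_all add: qpoch_nonzero)
  have v0: "v \<noteq> 0" using v by auto
  have "Bseq (\<lambda>k. v ^ k * (qpoch b q k * qpoch (b * u / v) q k * (1 / ?P k) * (1 / ?D k)))"
  proof (intro Bseq_mult Bseq_qpoch Bseq_inverse_qpoch q b2)
    show "Bseq (\<lambda>k. v ^ k)" using v by (intro BseqI'[of _ 1]) (simp add: norm_power)
  qed
  moreover have "v ^ k * (qpoch b q k * qpoch (b * u / v) q k * (1 / ?P k) * (1 / ?D k)) = e k" for k
    by (simp add: e_def qpoch_hom_eq[OF v0])
  ultimately have "Bseq e" by simp
  from Bseq_bound[OF this] obtain E where E: "0 \<le> E" "\<And>k. norm (e k) \<le> E" by blast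
  obtain G where G: "0 \<le> G" "\<And>k. norm (qpoch \<gamma> q k) \<le> G"
    using Bseq_bound[OF Bseq_qpoch[OF q, of \<gamma>]] by blast
  obtain H where H: "0 \<le> H" "\<And>k. norm (1 / ?P k) \<le> H"
    using Bseq_bound[OF Bseq_inverse_qpoch[OF q q]] by blast
  have bound: "norm (f k m) \<le> (G * E * H * norm t ^ k) * norm t ^ m" for k m
  proof -
    have "norm (qpoch \<gamma> q (k + m)) * norm (e k) * norm (1 / ?P m) \<le> G * E * H"
      by (intro mult_mono mult_nonneg_nonneg norm_ge_zero G E H)
    then have "norm (qpoch \<gamma> q (k + m)) * norm (e k) * norm (1 / ?P m) * (norm t ^ k * norm t ^ m)
        \<le> G * E * H * (norm t ^ k * norm t ^ m)"
      by (rule mult_right_mono) simp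
    then show ?thesis
      by (simp only: f_def norm_mult norm_power u mult_1_right mult.assoc)
  qed
  have sm: "summable (\<lambda>k. G * E * H * norm t ^ k)" "summable (\<lambda>k. norm t ^ k)"
    using t by (auto intro!: summable_mult summable_geometric)
  have nonneg: "0 \<le> G * E * H * norm t ^ k" "0 \<le> norm t ^ k" for k using G E H by simp_all
  note F = sum_rows_eq_sum_diagonals[of _ _ f, OF sm nonneg bound, of 1]
  define r where "r = (\<lambda>k. qpoch_inf (\<gamma> * t * u * q ^ k) q * (qpoch \<gamma> q k * qpoch b q k * qpoch_hom v (b * u) q k
          / (?P k * ?D k)) * t ^ k)"
  have row: "(\<Sum>m. f k m) = r k / qpoch_inf (t * u) q" for k
  proof -
    have "(\<lambda>m. qpoch \<gamma> q k * e k * t ^ k * (qpoch (\<gamma> * q ^ k) q m / ?P m * (t * u) ^ m))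
        sums (qpoch \<gamma> q k * e k * t ^ k * (qpoch_inf (\<gamma> * q ^ k * (t * u)) q / qpoch_inf (t * u) q))"
      by (intro sums_mult q_binomial_theorem q tu)
    moreover have "(\<lambda>m. qpoch \<gamma> q k * e k * t ^ k * (qpoch (\<gamma> * q ^ k) q m / ?P m * (t * u) ^ m)) = f k"
      by (simp add: f_def qpoch_add fun_eq_iff mult_ac)
    moreover have "qpoch \<gamma> q k * e k * t ^ k * (qpoch_inf (\<gamma> * q ^ k * (t * u)) q / qpoch_inf (t * u) q)
        = r k / qpoch_inf (t * u) q"
      by (simp add: r_def e_def mult_ac)
    ultimately show ?thesis by (simp add: sums_iff)
  qed
  have diag: "(\<Sum>m | 1 * m \<le> n. f (n - 1 * m) m) = qpoch \<gamma> q n / ?D n * rogers_hom u v b q n * t ^ n" for n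
  proof -
    have "(\<Sum>m | 1 * m \<le> n. f (n - 1 * m) m) = (\<Sum>k\<le>n. f k (n - k))"
      by (rule sum.reindex_bij_witness[of _ "\<lambda>k. n - k" "\<lambda>k. n - k"]) auto
    also have "\<dots> = qpoch \<gamma> q n / ?D n * rogers_hom u v b q n * t ^ n"
      unfolding rogers_hom_eq_sum_qpoch_hom[OF q] sum_distrib_left sum_distrib_right
    proof (intro sum.cong refl)
      fix k assume "k \<in> {..n}"
      then have k: "k + (n - k) = n" by simp
      have D: "?D n = ?D k * qpoch (b\<^sup>2 * q ^ k) q (n - k)"
        using qpoch_add[of "b\<^sup>2" q k "n - k"] unfolding k .
      have tn: "t ^ n = t ^ k * t ^ (n - k)" unfolding power_add[symmetric] k ..
      have "qpoch (b\<^sup>2 * q ^ k) q (n - k) \<noteq> 0" using nz(2)[of n] unfolding D by simp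
      then have ratio: "qpoch (b\<^sup>2 * q ^ k) q (n - k) / ?D n = 1 / ?D k" unfolding D by simp
      have "qpoch \<gamma> q n / ?D n
            * (qpoch b q k * qpoch (b\<^sup>2 * q ^ k) q (n - k) / (?P k * ?P (n - k))
              * qpoch_hom v (b * u) q k * u ^ (n - k)) * t ^ n
          = qpoch \<gamma> q n * (qpoch (b\<^sup>2 * q ^ k) q (n - k) / ?D n)
            * (qpoch b q k / (?P k * ?P (n - k)) * qpoch_hom v (b * u) q k * u ^ (n - k)) * t ^ n"
        by (simp add: mult_ac)
      also have "\<dots> = f k (n - k)"
        unfolding ratio f_def e_def k tn by (simp add: power_mult_distrib mult_ac)
      finally show "f k (n - k) = qpoch \<gamma> q n / ?D n
            * (qpoch b q k * qpoch (b\<^sup>2 * q ^ k) q (n - k) / (?P k * ?P (n - k))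
              * qpoch_hom v (b * u) q k * u ^ (n - k)) * t ^ n" by (rule sym)
    qed
    finally show ?thesis .
  qed
  have "(\<Sum>k. \<Sum>m. f k m) = (\<Sum>k. r k) / qpoch_inf (t * u) q"
  proof -
    have "summable (\<lambda>k. r k / qpoch_inf (t * u) q)" using F(1) by (simp add: row)
    then have "summable (\<lambda>k. r k / qpoch_inf (t * u) q * qpoch_inf (t * u) q)" by (rule summable_mult2)
    then have "summable r" using qpoch_inf_nonzero[OF tu q] by simp
    then show ?thesis by (simp add: row suminf_divide)
  qed
  with F(2) show ?thesis unfolding diag by (simp add: r_def)
qed

section \<open>The expansion in Rogers polynomials of another parameter\<close>

text \<open>
  On the unit circle the \<open>n + 1\<close> terms are bounded uniformly, so the polynomials grow at most
  linearly and a factor \<open>t\<^sup>n\<close> makes the double series of the theorem converge absolutely.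
\<close>

lemma norm_rogers_hom_le:
  assumes q: "norm q < 1" and u: "norm u = 1" and v: "norm v = 1"
  obtains K where "0 \<le> K" "\<And>n. norm (rogers_hom u v b q n) \<le> K * real (Suc n)"
proof -
  obtain B where B: "0 \<le> B" "\<And>n. norm (qpoch b q n / qpoch q q n) \<le> B"
    using Bseq_bound[OF Bseq_qpoch_quotient[OF q q, of b]] by blast
  have "norm (rogers_hom u v b q n) \<le> B * B * real (Suc n)" for n
  proof -
    have "norm (rogers_hom u v b q n) \<le> (\<Sum>j\<le>n. B * B)"
      unfolding rogers_hom_def
    proof (rule sum_norm_le)
      fix j
      have "norm (qpoch b q j / qpoch q q j) * norm (qpoch b q (n - j) / qpoch q q (n - j)) \<le> B * B"
        by (intro mult_mono B) auto
      then show "norm (qpoch b q j * qpoch b q (n - j) / (qpoch q q j * qpoch q q (n - j)) * u ^ (n - j) * v ^ j) \<le> B * B"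
        by (simp add: norm_mult norm_divide norm_power u v)
    qed
    then show ?thesis by (simp add: mult.commute)
  qed
  then show ?thesis using that[of "B * B"] B by simp
qed

text \<open>
  The \<open>\<plusminus>\<close> pairs of parameters: \<open>\<plusminus>g\<close> and \<open>\<plusminus>h\<close> collect the factors \<open>1 - c q\<^sup>j\<close> with \<open>j\<close> even and odd.
  Only the squares enter, which is why the choice of the square roots is immaterial.
\<close>

lemma qpoch_plus_minus_pairs:
  assumes "g\<^sup>2 = c" "h\<^sup>2 = c * q"
  shows "qpoch g q k * qpoch (- g) q k * (qpoch h q k * qpoch (- h) q k) = qpoch c q (2 * k)"
proof (induction k)
  case (Suc k)
  have "(1 - g * q ^ k) * (1 - - g * q ^ k) * ((1 - h * q ^ k) * (1 - - h * q ^ k))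
      = (1 - g\<^sup>2 * q ^ (2 * k)) * (1 - h\<^sup>2 * q ^ (2 * k))"
    by (simp add: mult_2 power_add) (simp add: algebra_simps power2_eq_square)
  then have "(1 - g * q ^ k) * (1 - - g * q ^ k) * ((1 - h * q ^ k) * (1 - - h * q ^ k))
      = (1 - c * q ^ (2 * k)) * (1 - c * q ^ Suc (2 * k))"
    unfolding assms by (simp add: mult_ac)
  with Suc show ?case by (simp add: qpoch_Suc mult_ac)
qed simp

theorem theorem6:
  fixes q \<gamma> t p :: complex and \<alpha> \<beta> \<theta> x :: real and g h :: "nat \<Rightarrow> complex"
  assumes "0 < norm q" and "norm q < 1"
    and "0 \<le> \<theta>" and "\<theta> \<le> pi" and "x = cos \<theta>"
    and "\<alpha> \<in> {-1<..<1} - {0}" and "\<beta> \<in> {-1<..<1} - {0}"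
    and "norm t < 1 - \<beta>\<^sup>2"
    and "p\<^sup>2 = q"
    and "\<And>n. (g n)\<^sup>2 = \<gamma> * q ^ n"
    and "\<And>n. (h n)\<^sup>2 = \<gamma> * q ^ (n + 1)"
  shows "(\<lambda>n. qpochs [of_real \<beta>, \<gamma>] q n * t ^ n / qpochs [of_real \<alpha>, of_real (\<beta>\<^sup>2)] q n
            * rogers n x (of_real \<alpha>) q
            * qhyp
                [of_real (\<beta> / \<alpha>), of_real \<beta> * q ^ n, g n, - g n, h n, - h n]
                [of_real \<alpha> * q ^ (n + 1), of_real \<beta> * p ^ n, - (of_real \<beta> * p ^ n),
                 of_real \<beta> * p ^ (n + 1), - (of_real \<beta> * p ^ (n + 1))]
                q (of_real \<alpha> * t\<^sup>2))
         sums
         (qhyp_reg [\<gamma>, of_real \<beta>, of_real \<beta> * cis (2 * \<theta>)] [of_real (\<beta>\<^sup>2)] (\<gamma> * t * cis \<theta>)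
            q (t * cis (- \<theta>))
          / qpoch_inf (t * cis \<theta>) q)"
proof -
  define a b u v where abuv: "a = complex_of_real \<alpha>" "b = complex_of_real \<beta>" "u = cis \<theta>" "v = cis (- \<theta>)"
  have q0: "q \<noteq> 0" and q: "norm q < 1" using assms by auto
  have a: "norm a < 1" "a \<noteq> 0" and b: "norm b < 1" using assms(6,7) by (auto simp: abuv)
  have uv: "norm u = 1" "norm v = 1" "u * v = 1" by (simp_all add: abuv cis_mult)
  have b2: "norm (b\<^sup>2) < 1" using b by (simp add: norm_power power_less_one_iff abs_square_less_1)
  have t: "norm t < 1" using assms(8) by (smt (verit) zero_le_power2)
  let ?P = "\<lambda>k. qpoch q q k" and ?A = "\<lambda>k. qpoch a q k" and ?D = "\<lambda>k. qpoch (b\<^sup>2) q k"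
  let ?G = "\<lambda>k. qpoch \<gamma> q k" and ?B = "\<lambda>k. qpoch b q k"
  have nz: "?P k \<noteq> 0" "?A k \<noteq> 0" "?D k \<noteq> 0" for k using q a b2 by (simp_all add: qpoch_nonzero)
  \<comment> \<open>The double series: row \<open>n\<close> belongs to \<open>C\<^sub>n(x; \<alpha> | q)\<close>, and the power of \<open>t\<close> is \<open>n + 2 k\<close>.\<close>
  define f where "f = (\<lambda>n k. ?G (n + 2 * k) / ?D (n + 2 * k) * (?B (n + k) * (1 / ?A (n + k + 1)))
      * (qpoch (b / a) q k / ?P k) * ((1 - a * q ^ n) * rogers_hom u v a q n) * t ^ n * (a * t\<^sup>2) ^ k)"

  obtain C1 where C1: "0 \<le> C1" "\<And>k. norm (?G k / ?D k) \<le> C1"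
    using Bseq_bound[OF Bseq_qpoch_quotient[OF b2 q, of \<gamma>]] by blast
  obtain C2 where C2: "0 \<le> C2" "\<And>k. norm (?B k) \<le> C2"
    using Bseq_bound[OF Bseq_qpoch[OF q, of b]] by blast
  obtain C3 where C3: "0 \<le> C3" "\<And>k. norm (1 / ?A k) \<le> C3"
    using Bseq_bound[OF Bseq_inverse_qpoch[OF a(1) q]] by blast
  obtain C4 where C4: "0 \<le> C4" "\<And>k. norm (qpoch (b / a) q k / ?P k) \<le> C4"
    using Bseq_bound[OF Bseq_qpoch_quotient[OF q q, of "b / a"]] by blast
  obtain C5 where C5: "0 \<le> C5" "\<And>n. norm (rogers_hom u v a q n) \<le> C5 * real (Suc n)"
    using norm_rogers_hom_le[OF q uv(1,2), of a] by blast
  define C where "C = C1 * (C2 * C3) * C4 * (2 * C5)"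
  have bound: "norm (f n k) \<le> (C * (real (Suc n) * norm t ^ n)) * (norm t ^ 2) ^ k" for n k
  proof -
    have two: "norm (1 - a * q ^ n) \<le> 2"
      using norm_triangle_ineq4[of 1 "a * q ^ n"] norm_mult_power_less_1[of a q n] a q by simp
    have at: "norm (a * t\<^sup>2) \<le> norm t ^ 2"
      using a by (simp add: norm_mult norm_power mult_left_le_one_le)
    have "norm (f n k) = norm (?G (n + 2 * k) / ?D (n + 2 * k)) * (norm (?B (n + k)) * norm (1 / ?A (n + k + 1)))
        * norm (qpoch (b / a) q k / ?P k) * (norm (1 - a * q ^ n) * norm (rogers_hom u v a q n))
        * norm t ^ n * norm (a * t\<^sup>2) ^ k"
      by (simp only: f_def norm_mult norm_power)
    also have "\<dots> \<le> C1 * (C2 * C3) * C4 * (2 * (C5 * real (Suc n))) * norm t ^ n * (norm t ^ 2) ^ k"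
      by (intro mult_mono C1 C2 C3 C4 C5 two at power_mono)
        (auto intro!: mult_nonneg_nonneg C1 C2 C3 C4 C5)
    finally show ?thesis by (simp only: C_def mult_ac)
  qed
  have "0 \<le> C" unfolding C_def using C1 C2 C3 C4 C5 by simp
  then have nonneg: "0 \<le> C * (real (Suc n) * norm t ^ n)" "0 \<le> (norm t ^ 2) ^ k" for n k by simp_all
  have "summable (\<lambda>n. C * (real (Suc n) * norm t ^ n))"
    using geometric_deriv_sums[of "norm t"] t by (intro summable_mult) (simp add: sums_iff)
  moreover have "summable (\<lambda>k. (norm t ^ 2) ^ k)"
    using t by (intro summable_geometric) (simp add: power_less_one_iff abs_square_less_1)
  ultimately have F: "summable (\<lambda>n. \<Sum>k. f n k)"
      "(\<lambda>n. \<Sum>k | 2 * k \<le> n. f (n - 2 * k) k) sums (\<Sum>n. \<Sum>k. f n k)"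
    using sum_rows_eq_sum_diagonals[of _ _ f 2, OF _ _ nonneg bound] by simp_all
  have rowsum: "summable (f n)" for n
    by (rule summable_comparison_test'[OF summable_mult[OF \<open>summable (\<lambda>k. (norm t ^ 2) ^ k)\<close>], of 0]) (rule bound)

  \<comment> \<open>Along \<open>n + 2 k\<close> constant the connection formula restores \<open>C\<^sub>n(x; \<beta> | q)\<close>.\<close>
  have diag: "(\<Sum>k | 2 * k \<le> n. f (n - 2 * k) k) = ?G n / ?D n * rogers_hom u v b q n * t ^ n" for n
    unfolding rogers_hom_connection[OF q a(1), of u v b n] sum_distrib_left sum_distrib_right
  proof (intro sum.cong refl)
    fix k assume "k \<in> {k. 2 * k \<le> n}"
    then have k: "n - 2 * k + 2 * k = n" "n - 2 * k + k = n - k" by auto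
    have tn: "t ^ n = t ^ (n - 2 * k) * (t\<^sup>2) ^ k"
      using k(1) by (simp flip: power_add power_mult)
    show "f (n - 2 * k) k = ?G n / ?D n * (qpoch_hom a b q k * ?B (n - k) * (1 - a * q ^ (n - 2 * k))
            / (?P k * ?A (n - k + 1)) * (u * v) ^ k * rogers_hom u v a q (n - 2 * k)) * t ^ n"
      unfolding f_def k tn uv qpoch_hom_eq[OF a(2)] by (simp add: power_mult_distrib mult_ac)
  qed

  \<comment> \<open>Each row is one term of the expansion, its \<open>\<^sub>6\<phi>\<^sub>5\<close> included.\<close>
  have row: "(\<Sum>k. f n k) = qpochs [b, \<gamma>] q n * t ^ n / qpochs [a, b\<^sup>2] q n * rogers n x a q
      * qhyp [b / a, b * q ^ n, g n, - g n, h n, - h n]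
          [a * q ^ (n + 1), b * p ^ n, - (b * p ^ n), b * p ^ (n + 1), - (b * p ^ (n + 1))] q (a * t\<^sup>2)"
    (is "_ = ?c * qhyp ?as ?bs q _") for n
  proof -
    have G: "qpoch (g n) q k * qpoch (- g n) q k * (qpoch (h n) q k * qpoch (- h n) q k)
        = qpoch (\<gamma> * q ^ n) q (2 * k)" for k
      by (rule qpoch_plus_minus_pairs) (simp_all add: assms(10,11))
    have D: "qpoch (b * p ^ n) q k * qpoch (- (b * p ^ n)) q k
          * (qpoch (b * p ^ (n + 1)) q k * qpoch (- (b * p ^ (n + 1))) q k)
        = qpoch (b\<^sup>2 * q ^ n) q (2 * k)" for k
      by (rule qpoch_plus_minus_pairs) (simp_all add: power_mult_distrib power_mult[symmetric] flip: assms(9),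
          simp_all add: mult.commute power_mult power_add power2_eq_square)
    have T: "qhyp_term ?as ?bs q (a * t\<^sup>2) k = qpoch (b / a) q k * qpoch (b * q ^ n) q k * qpoch (\<gamma> * q ^ n) q (2 * k)
        / (?P k * qpoch (a * q ^ (n + 1)) q k * qpoch (b\<^sup>2 * q ^ n) q (2 * k)) * (a * t\<^sup>2) ^ k" for k
      unfolding G[symmetric] D[symmetric] by (simp add: qhyp_term_def qpochs_def mult_ac)
    have R: "rogers n x a q = rogers_hom u v a q n"
      unfolding assms(5) abuv using assms q0 by (intro rogers_eq_rogers_hom) auto
    have "?A (n + k + 1) = ?A n * (1 - a * q ^ n) * qpoch (a * q ^ (n + 1)) q k" for k
      using qpoch_add[of a q "n + 1" k] by (simp add: qpoch_Suc)
    moreover have "1 - a * q ^ n \<noteq> 0"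
      using nz(2)[of "Suc n"] by (simp add: qpoch_Suc)
    ultimately have A: "1 / ?A (n + k + 1) * (1 - a * q ^ n) = 1 / (?A n * qpoch (a * q ^ (n + 1)) q k)" for k
      by simp
    have fk: "f n k = ?c * qhyp_term ?as ?bs q (a * t\<^sup>2) k" for k
    proof -
      have "f n k = ?G (n + 2 * k) / ?D (n + 2 * k) * ?B (n + k) * (1 / ?A (n + k + 1) * (1 - a * q ^ n))
          * (qpoch (b / a) q k / ?P k) * rogers_hom u v a q n * t ^ n * (a * t\<^sup>2) ^ k"
        by (simp only: f_def mult_ac)
      then show ?thesis
        unfolding A T R qpoch_add[of _ q n] by (simp add: qpochs_def mult_ac)
    qed
    \<comment> \<open>A vanishing prefactor gives no information on the convergence of the \<open>\<^sub>6\<phi>\<^sub>5\<close>.\<close>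
    show ?thesis
    proof (cases "?c = 0")
      case True then show ?thesis by (simp add: fk del: mult_eq_0_iff divide_eq_0_iff)
    next
      case False
      then have "summable (qhyp_term ?as ?bs q (a * t\<^sup>2))"
        using rowsum[of n] unfolding fk[abs_def] by (simp only: summable_cmult_iff simp_thms)
      then show ?thesis unfolding fk qhyp_def by (rule suminf_mult)
    qed
  qed

  have "qhyp_reg [\<gamma>, b, b * cis (2 * \<theta>)] [b\<^sup>2] (\<gamma> * t * u) q (t * v)
      = (\<Sum>k. qpoch_inf (\<gamma> * t * u * q ^ k) q * (qpoch \<gamma> q k * qpoch b q k * qpoch_hom v (b * u) q k
          / (qpoch q q k * qpoch (b\<^sup>2) q k)) * t ^ k)"
  proof -
    have "v \<noteq> 0" "b * u / v = b * cis (2 * \<theta>)"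
      by (simp_all add: abuv nonzero_divide_eq_eq mult.assoc cis_mult)
    from qpoch_hom_eq[OF this(1), of "b * u" q] this(2)
    show ?thesis unfolding qhyp_reg_def
      by (intro suminf_cong) (simp add: qpochs_def power_mult_distrib)
  qed
  with rogers_generating_function[OF q b uv(1,2) t, of \<gamma>]
  have "(\<lambda>n. ?G n / ?D n * rogers_hom u v b q n * t ^ n) sums
      (qhyp_reg [\<gamma>, b, b * cis (2 * \<theta>)] [b\<^sup>2] (\<gamma> * t * u) q (t * v) / qpoch_inf (t * u) q)"
    by simp
  from sums_unique2[OF this F(2)[unfolded diag]] summable_sums[OF F(1)]
  have "(\<lambda>n. \<Sum>k. f n k) sums
      (qhyp_reg [\<gamma>, b, b * cis (2 * \<theta>)] [b\<^sup>2] (\<gamma> * t * u) q (t * v) / qpoch_inf (t * u) q)"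
    by simp
  then show ?thesis unfolding row by (simp add: abuv)
qed

end
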